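(* Let $d \ge 1$, let $\mu$ be a positive measure on $\mathbb{R}^d$ with support $D = \operatorname{supp}\mu$ such that $0 < \int_D p(x)^2 \, d\mu(x) < \infty$ for every nonzero real polynomial $p$ in $d$ variables. Let $\Lambda \subset \mathbb{N}_0^d$ be a finite, nonempty, downward-closed set, and suppose that there is an $N$-point quadrature rule $\{(x_j, w_j)\}_{j=1}^N$, with nodes $x_j \in D$ and weights $w_j \in \mathbb{R}$, satisfying $$\sum_{j=1}^N w_j\, p(x_j) = \int_D p(x)\, d\mu(x) \qquad \text{for all } p \in P_\Lambda .$$ Then $N \ge L(\Lambda)$, where $L(\Lambda)$ is the maximal half-set size of $\Lambda$.
   Context: Here $\mathbb{N}_0 = \{0,1,2,\dots\}$, and $N$ denotes the number of quadrature points (not the size of $\Lambda$). For $x = (x^{(1)},\dots,x^{(d)}) \in \mathbb{R}^d$ and $\alpha \in \mathbb{N}_0^d$, $x^\alpha = \prod_{j=1}^d (x^{(j)})^{\alpha^{(j)}}$. For a finite multi-index set $\Lambda \subset \mathbb{N}_0^d$, $P_\Lambda = \operatorname{span}\{x^\alpha : \alpha \in \Lambda\}$ (real span). $\Lambda$ is downward closed if $\alpha \in \Lambda$ implies $\beta \in \Lambda$ for all $\beta \in \mathbb{N}_0^d$ with $\beta \le \alpha$ (componentwise). The Minkowski sum is $\Theta + \Theta = \{\alpha + \beta : \alpha, \beta \in \Theta\}$. The maximal half-set size of $\Lambda$ is $$L(\Lambda) = \max\{ |\Theta| \;:\; \Theta \subset \mathbb{N}_0^d,\ \Theta + \Theta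 \subseteq \Lambda \}.$$ *)

theory Defs
  imports "HOL-Analysis.Analysis" "HOL-Analysis.Finite_Function_Topology"
begin

text \<open>
  Multi-indices are vectors of type \<^typ>\<open>nat ^ 'd\<close> (with the componentwise order), where \<open>d\<close> is
  \<open>CARD('d)\<close>. Real polynomials in \<open>d\<close> variables are the formal polynomials, i.e. the finitely
  supported coefficient families, of type \<^typ>\<open>(nat ^ 'd) \<Rightarrow>\<^sub>0 real\<close>.
\<close>

type_synonym 'd rpoly = "(nat ^ 'd) \<Rightarrow>\<^sub>0 real"

definition mpower :: "real ^ 'd \<Rightarrow> nat ^ 'd \<Rightarrow> real" where
  "mpower x \<alpha> = (\<Prod>j\<in>UNIV. (x $ j) ^ (\<alpha> $ j))"

definition reval :: "'d::finite rpoly \<Rightarrow> real ^ 'd \<Rightarrow> real" where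
  "reval p x = (\<Sum>\<alpha>\<in>Poly_Mapping.keys p. Poly_Mapping.lookup p \<alpha> * mpower x \<alpha>)"

definition rmonom :: "nat ^ 'd \<Rightarrow> 'd::finite rpoly" where
  "rmonom \<alpha> = Poly_Mapping.single \<alpha> 1"

definition P_space :: "(nat ^ 'd) set \<Rightarrow> 'd::finite rpoly set" where
  "P_space \<Lambda> = span (rmonom ` \<Lambda>)"

definition downward_closed :: "(nat ^ 'd) set \<Rightarrow> bool" where
  "downward_closed \<Lambda> \<longleftrightarrow> (\<forall>\<alpha>\<in>\<Lambda>. \<forall>\<beta>. \<beta> \<le> \<alpha> \<longrightarrow> \<beta> \<in> \<Lambda>)"

text \<open>
  \<open>\<Theta> + \<Theta>\<close> is the Minkowski sum. The definition is meant for finite \<open>\<Lambda>\<close>: then every admissible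
  \<open>\<Theta>\<close> is finite (\<open>\<alpha> \<mapsto> \<alpha> + \<alpha>\<close> injects it into \<open>\<Lambda>\<close>), and the maximum is over a finite set that
  contains \<open>0\<close> (from \<open>\<Theta> = {}\<close>).
\<close>
definition max_half_set_size :: "(nat ^ 'd) set \<Rightarrow> nat" where
  "max_half_set_size \<Lambda> = Max {card \<Theta> |\<Theta>. \<Theta> + \<Theta> \<subseteq> \<Lambda>}"

definition measure_support :: "'a::topological_space measure \<Rightarrow> 'a set" where
  "measure_support \<mu> = {x. \<forall>U. open U \<and> x \<in> U \<longrightarrow> emeasure \<mu> U > 0}"

end

theory Submission
  imports Defs
begin

text \<open>If \<open>\<Theta> + \<Theta> \<subseteq> \<Lambda>\<close> and \<open>card \<Theta> > N\<close>, then linear algebra yields a nonzero \<open>p \<in> P_space \<Theta>\<close> that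
  vanishes at all \<open>N\<close> nodes. Its square lies in \<open>P_space \<Lambda>\<close>, so the quadrature rule gives
  \<open>\<integral> p\<^sup>2 d\<mu> = 0\<close>, contradicting the positivity assumption on \<open>\<mu>\<close>.\<close>

text \<open>Gaussian elimination by induction on the number \<open>N\<close> of equations: a last
  equation with only zero coefficients is dropped; otherwise a pivot in it removes one unknown along
  with that equation.\<close>

lemma underdetermined_system_nontrivial_solution:
  fixes f :: "'a \<Rightarrow> nat \<Rightarrow> 'b::field"
  assumes "finite A" "N < card A"
  shows "\<exists>c. (\<exists>a\<in>A. c a \<noteq> 0) \<and> (\<forall>j\<in>{1..N}. (\<Sum>a\<in>A. c a * f a j) = 0)"
  using assms
proof (induction N arbitrary: A f)
  case 0
  then obtain a where "a \<in> A" by fastforce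
  then show ?case by (intro exI[of _ "\<lambda>_. 1"]) auto
next
  case (Suc N)
  show ?case
  proof (cases "\<forall>a\<in>A. f a (Suc N) = 0")
    case True
    obtain c where "\<exists>a\<in>A. c a \<noteq> 0" "\<forall>j\<in>{1..N}. (\<Sum>a\<in>A. c a * f a j) = 0"
      using Suc.IH[of A f] Suc.prems by auto
    with True show ?thesis
      by (intro exI[of _ c]) (auto simp: le_Suc_eq)
  next
    case False
    then obtain b where b: "b \<in> A" "f b (Suc N) \<noteq> 0" by blast
    \<comment> \<open>With pivot \<open>f b (Suc N)\<close>, subtracting \<open>r a\<close> times
      column \<open>b\<close> from column \<open>a\<close> cancels the coefficient of
      \<open>a\<close> in the last equation.\<close>
    define r where "r a = f a (Suc N) / f b (Suc N)" for a
    have "N < card (A - {b})"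
      using Suc.prems b(1) by simp
    with Suc.prems(1) obtain c where c: "\<exists>a\<in>A - {b}. c a \<noteq> 0"
        "\<forall>j\<in>{1..N}. (\<Sum>a\<in>A - {b}. c a * (f a j - r a * f b j)) = 0"
      using Suc.IH[of "A - {b}" "\<lambda>a j. f a j - r a * f b j"] by blast
    define s where "s = (\<Sum>a\<in>A - {b}. c a * r a)"
    \<comment> \<open>The value at \<open>b\<close> absorbs the corrections
      \<open>r a * f b j\<close>, so the original system at \<open>c'\<close> agrees with the
      reduced one at \<open>c\<close>.\<close>
    define c' where "c' = c(b := - s)"
    have "(\<Sum>a\<in>A. c' a * f a j) = (\<Sum>a\<in>A - {b}. c a * (f a j - r a * f b j))" for j
    proof -
      have "(\<Sum>a\<in>A. c' a * f a j) = c' b * f b j + (\<Sum>a\<in>A - {b}. c' a * f a j)"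
        using Suc.prems(1) b(1) by (rule sum.remove)
      also have "(\<Sum>a\<in>A - {b}. c' a * f a j) = (\<Sum>a\<in>A - {b}. c a * f a j)"
        by (rule sum.cong) (auto simp: c'_def)
      finally show ?thesis
        by (simp add: c'_def s_def right_diff_distrib sum_subtractf sum_distrib_right mult.assoc)
    qed
    moreover have "(\<Sum>a\<in>A - {b}. c a * (f a (Suc N) - r a * f b (Suc N))) = 0"
      using b(2) by (simp add: r_def)
    ultimately have "\<forall>j\<in>{1..Suc N}. (\<Sum>a\<in>A. c' a * f a j) = 0"
      using c(2) by (auto simp: le_Suc_eq)
    moreover have "\<exists>a\<in>A. c' a \<noteq> 0"
      using c(1) by (auto simp: c'_def)
    ultimately show ?thesis by blast
  qed
qed

text \<open>Lets polynomials with different supports be evaluated over one common finite index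
  set.\<close>

lemma reval_eq_sum_superset:
  assumes "finite S" "Poly_Mapping.keys p \<subseteq> S"
  shows "reval p y = (\<Sum>\<alpha>\<in>S. Poly_Mapping.lookup p \<alpha> * mpower y \<alpha>)"
  unfolding reval_def using assms
  by (intro sum.mono_neutral_left) (auto simp: in_keys_iff)

lemma reval_0 [simp]: "reval 0 y = 0"
  by (simp add: reval_def)

lemma reval_add: "reval (p + q) y = reval p y + reval q y"
proof -
  let ?S = "Poly_Mapping.keys p \<union> Poly_Mapping.keys q"
  show ?thesis
    using keys_add[of p q]
    by (simp add: reval_eq_sum_superset[of ?S] lookup_add distrib_right sum.distrib)
qed

lemma reval_sum: "reval (\<Sum>i\<in>I. p i) y = (\<Sum>i\<in>I. reval (p i) y)"
  by (induction I rule: infinite_finite_induct) (simp_all add: reval_add)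

lemma reval_single [simp]: "reval (Poly_Mapping.single \<alpha> c) y = c * mpower y \<alpha>"
  by (simp add: reval_eq_sum_superset[of "{\<alpha>}"])

lemma mpower_add: "mpower y (\<alpha> + \<beta>) = mpower y \<alpha> * mpower y \<beta>"
  by (simp add: mpower_def power_add prod.distrib)

lemma continuous_on_reval: "continuous_on S (reval p)"
  unfolding reval_def mpower_def by (intro continuous_intros)

lemma single_in_P_space:
  assumes "\<alpha> \<in> \<Lambda>"
  shows "Poly_Mapping.single \<alpha> c \<in> P_space \<Lambda>"
proof -
  have "Poly_Mapping.single \<alpha> c = c *\<^sub>R rmonom \<alpha>"
  proof -
    have "(\<lambda>i. c *\<^sub>R Poly_Mapping.lookup (rmonom \<alpha>) i) = Poly_Mapping.lookup (Poly_Mapping.single \<alpha> c)"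
      by (auto simp: rmonom_def lookup_single when_def)
    then show ?thesis
      by (simp add: scaleR_poly_mapping_def lookup_inverse)
  qed
  then show ?thesis
    unfolding P_space_def using assms by (simp add: span_base span_scale)
qed

text \<open>The complement is the union of all open null sets. Closedness makes the support a Borel
  set.\<close>

lemma closed_measure_support: "closed (measure_support \<mu>)"
proof -
  have "- measure_support \<mu> = \<Union>{U. open U \<and> emeasure \<mu> U = 0}"
    by (auto simp: measure_support_def)
  then have "open (- measure_support \<mu>)" by auto
  then show ?thesis by (simp add: closed_def)
qed

lemma half_set_card_le:
  fixes \<mu> :: "(real ^ 'd::finite) measure"
  assumes sets: "sets \<mu> = sets borel" and D: "D \<in> sets borel"
    and pos: "\<And>p :: 'd rpoly. p \<noteq> 0 \<Longrightarrow>
           0 < (\<integral>\<^sup>+y\<in>D. ennreal ((reval p y)\<^sup>2) \<partial>\<mu>) \<and>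
           (\<integral>\<^sup>+y\<in>D. ennreal ((reval p y)\<^sup>2) \<partial>\<mu>) < \<infinity>"
    and quad: "\<And>p. p \<in> P_space \<Lambda> \<Longrightarrow>
           (\<Sum>j=1..N. w j * reval p (x j)) = (LINT y:D|\<mu>. reval p y)"
    and half: "\<Theta> + \<Theta> \<subseteq> \<Lambda>"
  shows "card \<Theta> \<le> N"
proof (rule ccontr)
  assume "\<not> card \<Theta> \<le> N"
  \<comment> \<open>Infinite sets have \<open>card\<close> 0, so the strict bound also forces
    \<Theta> to be finite.\<close>
  then have N: "N < card \<Theta>" and fin: "finite \<Theta>"
    by (auto intro: card_ge_0_finite)
  obtain c where c: "\<exists>\<alpha>\<in>\<Theta>. c \<alpha> \<noteq> 0"
      "\<forall>j\<in>{1..N}. (\<Sum>\<alpha>\<in>\<Theta>. c \<alpha> * mpower (x j) \<alpha>) = 0"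
    using underdetermined_system_nontrivial_solution[OF fin N, of "\<lambda>\<alpha> j. mpower (x j) \<alpha>"] by blast
  define p :: "'d rpoly" where "p = (\<Sum>\<alpha>\<in>\<Theta>. Poly_Mapping.single \<alpha> (c \<alpha>))"
  \<comment> \<open>The square of \<open>p\<close>, expanded into monomials so that every exponent
    visibly lies in \<Theta> + \<Theta>, hence in \<Lambda>.\<close>
  define q :: "'d rpoly" where
    "q = (\<Sum>\<alpha>\<in>\<Theta>. \<Sum>\<beta>\<in>\<Theta>. Poly_Mapping.single (\<alpha> + \<beta>) (c \<alpha> * c \<beta>))"
  have p: "reval p y = (\<Sum>\<alpha>\<in>\<Theta>. c \<alpha> * mpower y \<alpha>)" for y
    by (simp add: p_def reval_sum)
  have q: "reval q y = (reval p y)\<^sup>2" for y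
    by (simp add: p q_def reval_sum mpower_add power2_eq_square sum_product mult_ac)
  \<comment> \<open>The exponents are distinct, so no coefficients merge and \<open>p\<close> is
    nonzero as a formal polynomial.\<close>
  have "Poly_Mapping.lookup p \<alpha> = c \<alpha>" if "\<alpha> \<in> \<Theta>" for \<alpha>
    using that fin by (simp add: p_def lookup_sum lookup_single when_def)
  with c(1) have "p \<noteq> 0" by auto
  then have fin_pos: "0 < (\<integral>\<^sup>+y\<in>D. ennreal ((reval p y)\<^sup>2) \<partial>\<mu>)"
      "(\<integral>\<^sup>+y\<in>D. ennreal ((reval p y)\<^sup>2) \<partial>\<mu>) < \<infinity>"
    using pos by blast+
  have "q \<in> P_space \<Lambda>"
    unfolding q_def P_space_def
    by (intro span_sum single_in_P_space[unfolded P_space_def] subsetD[OF half] set_plus_intro)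
  then have "(LINT y:D|\<mu>. reval q y) = (\<Sum>j=1..N. w j * reval q (x j))"
    by (rule quad[symmetric])
  also have "\<dots> = 0"
    using c(2) by (intro sum.neutral) (simp add: q p)
  finally have "(LINT y|\<mu>. indicator D y * (reval p y)\<^sup>2) = 0"
    by (simp add: set_lebesgue_integral_def q)
  \<comment> \<open>The quadrature rule speaks of the Bochner integral, positivity of the
    nonnegative one; for a nonnegative measurable integrand \<open>enn2real\<close> links
    them.\<close>
  moreover have "(LINT y|\<mu>. indicator D y * (reval p y)\<^sup>2)
      = enn2real (\<integral>\<^sup>+y. ennreal (indicator D y * (reval p y)\<^sup>2) \<partial>\<mu>)"
  proof (rule integral_eq_nn_integral)
    have "reval p \<in> borel_measurable borel"
      by (intro borel_measurable_continuous_onI continuous_on_reval)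
    then have "(\<lambda>y. indicator D y * (reval p y)\<^sup>2) \<in> borel_measurable borel"
      using D by measurable
    then show "(\<lambda>y. indicator D y * (reval p y)\<^sup>2) \<in> borel_measurable \<mu>"
      by (simp add: measurable_cong_sets[OF sets refl])
  qed auto
  moreover have "(\<integral>\<^sup>+y. ennreal (indicator D y * (reval p y)\<^sup>2) \<partial>\<mu>)
      = (\<integral>\<^sup>+y\<in>D. ennreal ((reval p y)\<^sup>2) \<partial>\<mu>)"
    by (intro nn_integral_cong) (simp split: split_indicator)
  \<comment> \<open>\<open>enn2real\<close> vanishes at 0 and at infinity, so both the positivity
    and the finiteness of the integral are used.\<close>
  ultimately show False
    using fin_pos by (auto simp: enn2real_eq_0_iff)
qed

theorem theorem2p2:
  fixes \<mu> :: "(real ^ 'd::finite) measure"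
    and D :: "(real ^ 'd) set"
    and \<Lambda> :: "(nat ^ 'd) set"
    and N :: nat
    and x :: "nat \<Rightarrow> real ^ 'd"
    and w :: "nat \<Rightarrow> real"
  assumes "sets \<mu> = sets borel"
    and "D = measure_support \<mu>"
    and "\<And>p :: 'd rpoly. p \<noteq> 0 \<Longrightarrow>
           0 < (\<integral>\<^sup>+y\<in>D. ennreal ((reval p y)\<^sup>2) \<partial>\<mu>) \<and>
           (\<integral>\<^sup>+y\<in>D. ennreal ((reval p y)\<^sup>2) \<partial>\<mu>) < \<infinity>"
    and "finite \<Lambda>" and "\<Lambda> \<noteq> {}" and "downward_closed \<Lambda>"
    and "\<And>j. j \<in> {1..N} \<Longrightarrow> x j \<in> D"
    and "\<And>p. p \<in> P_space \<Lambda> \<Longrightarrow>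
           (\<Sum>j=1..N. w j * reval p (x j)) = (LINT y:D|\<mu>. reval p y)"
  shows "N \<ge> max_half_set_size \<Lambda>"
proof -
  have le: "card \<Theta> \<le> N" if "\<Theta> + \<Theta> \<subseteq> \<Lambda>" for \<Theta>
    using assms(1) _ assms(3,8) that
    by (rule half_set_card_le) (simp add: assms(2) closed_measure_support)
  \<comment> \<open>\<open>Max\<close> is meaningful only on a finite nonempty set: the bound
    \<open>N\<close> gives finiteness, and the empty half-set gives nonemptiness.\<close>
  then have "finite {card \<Theta> |\<Theta>. \<Theta> + \<Theta> \<subseteq> \<Lambda>}"
    by (intro finite_subset[OF _ finite_atMost[of N]]) auto
  moreover have "{} + {} \<subseteq> \<Lambda>"
    by (simp add: set_plus_def)
  ultimately show ?thesis
    unfolding max_half_set_size_def using le by (intro Max.boundedI) blast+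
qed

end
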